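(* Let $k\subset\mathbb{R}^2$ be the circle $(x-\frac32)^2+y^2=\frac54$ with center $c=(\frac32,0)$, and let $Y=\{p_1,p_2,\dots\}\subset k$ be the countable set of points on $k$ given by $$Y=\left\{p(\alpha):=\left(\frac{1}{(\beta-\frac32)s'+\gamma s+\frac32},\ \frac{(\frac32-\beta)s+\gamma s'}{(\beta-\frac32)s'+\gamma s+\frac32}\right)\;\bigg|\;\alpha\in\mathbb{Q}\right\},$$ where $$\beta=\frac{2+2\alpha^2}{5-2\alpha+\alpha^2},\quad \gamma=\frac{1+4\alpha-\alpha^2}{5-2\alpha+\alpha^2},\quad s=\sin 1,\quad s'=\cos 1.$$ The set $Y$ is dense in $k$, and in every straightedge deterministic (not necessarily terminating) $\mathrm{EC}_{\infty}(\emptyset)$ $T=(r,V,E)$ with root $r=kp_1p_2\dots$, for every vertex $u\in V$ the point $c$ is not a letter of $u$. Thus no straightedge deterministic $\mathrm{EC}_{\infty}(\emptyset)$ constructs $\mathcal{K}=\{c\}$ (the center $c$ of $k$) from $r$ (the given circle $k$ plus the infinitely many points $Y$ on it).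
   Context: A rooted tree $T=(r,V,E)$ consists of a vertex set $V$, a root $r\in V$ and edges $E\subset V\times V$ such that for every $u\in V$ there is a unique walk from $r$ to $u$; if $(u,v)\in E$ then $v$ is a child of $u$; a leaf is a vertex with no child; a branch is a maximal (finite or infinite) walk. $\mathcal{P}=\mathbb{R}^2$ is the set of points, $\mathcal{L}$ the set of lines in $\mathbb{R}^2$, $\mathcal{C}$ the set of circles of positive radius in $\mathbb{R}^2$; elements of $\mathcal{L}\cup\mathcal{C}$ are called curves. For points $a\ne b$, $l(a,b)$ is the line through $a,b$. For points $a$ and $b\neq c$, $k(a,b,c)$ is the circle with center $a$ and radius $|bc|$; moreover $k(a,b,b)=a\in\mathcal{P}$. A set $Y\subset k$ is dense in the circle $k$ if $Y\cap D\ne\emptyset$ for every open disc $D$ of positive radius intersecting $k$. A deterministic Euclidean construction with infinite configurations, denoted $\mathrm{EC}_\infty(\emptyset)$, is a rooted tree $T=(r,V,E)$ whose root is an infinite word $r=a_0a_1\dots$ of length $\omega$ and whose other vertices are words $a_0a_1\dots;a_\omega a_{\omega+1}\dots a_{\omega+i}$ with $i\in\{0,1,2,\dots\}$ (indexed by the ordinal $\omega+i+1$), all letters being in $\mathcal{P}\cup\mathcal{L}\cup\mathcal{C}$. Each vertex $u$ either is a leaf or has exactly one child $v$, which is $u$ with one letter $a$ appended at the end (at index $\omega$ if $u=r$, at index $\omega+i+1$ if the last index in $u$ is $\omega+i$), where $a$ is one of the following: (line rule) $a=l(p,q)$ for two distinct points $p,q$ that are letters of $u$; (circle rule) $a=k(p,q,t)$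 for some (not necessarily distinct) points $p,q,t$ that are letters of $u$; (intersection rule) $a\in\mathcal{P}$ is an intersection point of two distinct curves that are letters of $u$. $T$ is a straightedge construction if the circle rule is never used with $q\ne t$. $T$ is terminating if all its branches are finite. For a set $\mathcal{K}$ of finite words over $\mathcal{P}\cup\mathcal{L}\cup\mathcal{C}$ (here the one-letter word $c$), an $\mathrm{EC}_\infty(\emptyset)$ of a certain type constructs $\mathcal{K}$ from $r$ if there is a terminating $\mathrm{EC}_\infty(\emptyset)$ $T=(r,V,E)$ of that type with root $r$ such that every leaf of $T$ has a final segment belonging to $\mathcal{K}$. *)

theory Defs
  imports "HOL-Analysis.Analysis" "HOL-Library.Sublist"
begin

record 'v tree =
  troot :: 'v
  verts :: "'v set"
  edges :: "('v \<times> 'v) set"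

datatype 'v walk = Fin_walk "'v list" | Inf_walk "nat \<Rightarrow> 'v"

fun is_walk :: "'v tree \<Rightarrow> 'v walk \<Rightarrow> bool" where
  "is_walk T (Fin_walk us) \<longleftrightarrow>
     us \<noteq> [] \<and> set us \<subseteq> verts T \<and> successively (\<lambda>u v. (u, v) \<in> edges T) us"
| "is_walk T (Inf_walk f) \<longleftrightarrow>
     range f \<subseteq> verts T \<and> (\<forall>n. (f n, f (Suc n)) \<in> edges T)"

fun subwalk :: "'v walk \<Rightarrow> 'v walk \<Rightarrow> bool" where
  "subwalk (Fin_walk us) (Fin_walk vs) \<longleftrightarrow> sublist us vs"
| "subwalk (Fin_walk us) (Inf_walk g) \<longleftrightarrow> (\<exists>i. us = map g [i..<i + length us])"
| "subwalk (Inf_walk f) (Fin_walk vs) \<longleftrightarrow> False"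
| "subwalk (Inf_walk f) (Inf_walk g) \<longleftrightarrow> (\<exists>i. \<forall>n. f n = g (i + n))"

definition branch :: "'v tree \<Rightarrow> 'v walk \<Rightarrow> bool" where
  "branch T W \<longleftrightarrow> is_walk T W \<and> (\<forall>W'. is_walk T W' \<and> subwalk W W' \<longrightarrow> W' = W)"

definition rooted_tree :: "'v tree \<Rightarrow> bool" where
  "rooted_tree T \<longleftrightarrow>
     troot T \<in> verts T \<and> edges T \<subseteq> verts T \<times> verts T \<and>
     (\<forall>u\<in>verts T. \<exists>!us. is_walk T (Fin_walk us) \<and> hd us = troot T \<and> last us = u)"

definition children :: "'v tree \<Rightarrow> 'v \<Rightarrow> 'v set" where
  "children T u = {v. (u, v) \<in> edges T}"

definition leaf :: "'v tree \<Rightarrow> 'v \<Rightarrow> bool" where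
  "leaf T u \<longleftrightarrow> u \<in> verts T \<and> children T u = {}"

definition terminating :: "'v tree \<Rightarrow> bool" where
  "terminating T \<longleftrightarrow> (\<forall>W. branch T W \<longrightarrow> (\<exists>us. W = Fin_walk us))"

type_synonym point = "real \<times> real"

definition line_through :: "point \<Rightarrow> point \<Rightarrow> point set" where
  "line_through a b = affine hull {a, b}"

definition all_lines :: "point set set" where
  "all_lines = {line_through a b |a b. a \<noteq> b}"

definition all_circles :: "point set set" where
  "all_circles = {sphere a \<rho> |a \<rho>. \<rho> > 0}"

datatype letter = Point point | Curve "point set"

definition alphabet :: "letter set" where
  "alphabet = range Point \<union> Curve ` (all_lines \<union> all_circles)"

definition kcirc :: "point \<Rightarrow> point \<Rightarrow> point \<Rightarrow> letter" where
  "kcirc a b c = (if b = c then Point a else Curve (sphere a (dist b c)))"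

text \<open>A word of length \<open>\<omega> + n\<close> with \<open>n\<close> finite is the pair of its initial \<open>\<omega>\<close>-word
  \<open>a\<^sub>0a\<^sub>1\<dots>\<close> and the list of its last \<open>n\<close> letters, those with indices
  \<open>\<omega>, \<omega> + 1, \<dots>\<close>.\<close>

type_synonym omega_word = "(nat \<Rightarrow> letter) \<times> letter list"

definition letters :: "omega_word \<Rightarrow> letter set" where
  "letters u = range (fst u) \<union> set (snd u)"

definition append_letter :: "omega_word \<Rightarrow> letter \<Rightarrow> omega_word" where
  "append_letter u a = (fst u, snd u @ [a])"

text \<open>A nonempty final segment of an \<open>\<omega>\<close>-word is infinite, so the finite final segments
  of a word are exactly the suffixes of its list part.\<close>

definition final_segment :: "letter list \<Rightarrow> omega_word \<Rightarrow> bool" where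
  "final_segment ys u \<longleftrightarrow> suffix ys (snd u)"

definition line_rule :: "omega_word \<Rightarrow> letter \<Rightarrow> bool" where
  "line_rule u a \<longleftrightarrow>
     (\<exists>p q. p \<noteq> q \<and> Point p \<in> letters u \<and> Point q \<in> letters u \<and>
            a = Curve (line_through p q))"

definition circle_rule_at ::
    "omega_word \<Rightarrow> letter \<Rightarrow> point \<Rightarrow> point \<Rightarrow> point \<Rightarrow> bool" where
  "circle_rule_at u a p q t \<longleftrightarrow>
     Point p \<in> letters u \<and> Point q \<in> letters u \<and> Point t \<in> letters u \<and> a = kcirc p q t"

definition intersection_rule :: "omega_word \<Rightarrow> letter \<Rightarrow> bool" where
  "intersection_rule u a \<longleftrightarrow>
     (\<exists>C D x. C \<noteq> D \<and> Curve C \<in> letters u \<and> Curve D \<in> letters u \<and>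
              x \<in> C \<inter> D \<and> a = Point x)"

definition construction_step :: "omega_word \<Rightarrow> letter \<Rightarrow> bool" where
  "construction_step u a \<longleftrightarrow>
     line_rule u a \<or> (\<exists>p q t. circle_rule_at u a p q t) \<or> intersection_rule u a"

definition EC_inf :: "omega_word tree \<Rightarrow> bool" where
  "EC_inf T \<longleftrightarrow>
     rooted_tree T \<and>
     snd (troot T) = [] \<and> (\<forall>u\<in>verts T - {troot T}. snd u \<noteq> []) \<and>
     (\<forall>u\<in>verts T. letters u \<subseteq> alphabet) \<and>
     (\<forall>u\<in>verts T. leaf T u \<or>
        (\<exists>a. construction_step u a \<and> children T u = {append_letter u a}))"

text \<open>A letter that arises from the circle rule with \<open>q \<noteq> t\<close> is a circle of positive
  radius, so no other rule yields it; hence it is enough to look at the letters which the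
  edges append, although the tree does not record which rules were applied.\<close>

definition straightedge :: "omega_word tree \<Rightarrow> bool" where
  "straightedge T \<longleftrightarrow>
     \<not> (\<exists>u a p q t. (u, append_letter u a) \<in> edges T \<and> circle_rule_at u a p q t \<and> q \<noteq> t)"

definition constructs ::
    "(omega_word tree \<Rightarrow> bool) \<Rightarrow> letter list set \<Rightarrow> omega_word \<Rightarrow> bool" where
  "constructs ty K r \<longleftrightarrow>
     (\<exists>T. EC_inf T \<and> ty T \<and> terminating T \<and> troot T = r \<and>
          (\<forall>u. leaf T u \<longrightarrow> (\<exists>ys\<in>K. final_segment ys u)))"

definition dense_in_circle :: "point set \<Rightarrow> point set \<Rightarrow> bool" where
  "dense_in_circle S C \<longleftrightarrow>
     S \<subseteq> C \<and> (\<forall>a \<rho>. \<rho> > 0 \<and> ball a \<rho> \<inter> C \<noteq> {} \<longrightarrow> S \<inter> ball a \<rho> \<noteq> {})"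

definition k0 :: "point set" where
  "k0 = {(x, y). (x - 3/2)\<^sup>2 + y\<^sup>2 = 5/4}"

definition c0 :: point where
  "c0 = (3/2, 0)"

lemma k0_eq_sphere: "k0 = sphere c0 (sqrt (5/4))"
proof (rule set_eqI)
  fix z :: point
  obtain x y where z: "z = (x, y)" by (cases z)
  have "dist c0 z = sqrt ((x - 3/2)\<^sup>2 + y\<^sup>2)"
    unfolding c0_def z dist_prod_def fst_conv snd_conv dist_real_def power2_abs
    by (simp only: power2_commute[of "3/2" x] diff_0 power2_minus)
  then have "z \<in> sphere c0 (sqrt (5/4)) \<longleftrightarrow> (x - 3/2)\<^sup>2 + y\<^sup>2 = 5/4"
    by (simp only: mem_sphere real_sqrt_eq_iff)
  then show "z \<in> k0 \<longleftrightarrow> z \<in> sphere c0 (sqrt (5/4))"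
    by (simp only: k0_def z mem_Collect_eq case_prod_conv)
qed

lemma k0_circle: "k0 \<in> all_circles"
proof -
  have "sqrt (5/4) > (0::real)" by simp
  then show ?thesis unfolding all_circles_def k0_eq_sphere by blast
qed

definition beta :: "real \<Rightarrow> real" where
  "beta \<alpha> = (2 + 2 * \<alpha>\<^sup>2) / (5 - 2 * \<alpha> + \<alpha>\<^sup>2)"

definition gamma :: "real \<Rightarrow> real" where
  "gamma \<alpha> = (1 + 4 * \<alpha> - \<alpha>\<^sup>2) / (5 - 2 * \<alpha> + \<alpha>\<^sup>2)"

text \<open>No denominator vanishes: \<open>5 - 2 * \<alpha> + \<alpha>\<^sup>2 \<ge> 4\<close>, and \<open>(beta \<alpha>, gamma \<alpha>)\<close> is
  a point of \<open>k0\<close>, so \<open>d \<ge> 3/2 - sqrt (5/4) > 0\<close>; \<open>pt \<alpha>\<close> is that point, rotated about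
  the center by the angle \<open>- 1\<close>, under the map \<open>(x, y) \<mapsto> (1/x, y/x)\<close> of \<open>k0\<close> to itself.\<close>

definition pt :: "real \<Rightarrow> point" where
  "pt \<alpha> = (let s = sin 1; s' = cos 1; d = (beta \<alpha> - 3/2) * s' + gamma \<alpha> * s + 3/2
           in (1 / d, ((3/2 - beta \<alpha>) * s + gamma \<alpha> * s') / d))"

definition Y0 :: "point set" where
  "Y0 = {pt \<alpha> |\<alpha>. \<alpha> \<in> \<rat>}"

definition root_word :: "(nat \<Rightarrow> point) \<Rightarrow> omega_word" where
  "root_word p = (\<lambda>n. if n = 0 then Curve k0 else Point (p n), [])"

end

(* Send (x, y) to (h1 : h2 : h3), the homogeneous coordinates, relative to the center of k0, of the
   point that the rotation and the map (x, y) \<mapsto> (1/x, y/x) take to (x, y). Up to a common factor the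
   coordinates of the points of Y0 are rational, and k0 is h1^2 + h2^2 = 5/4 h3^2. Joining points,
   intersecting lines and intersecting a line with k0 preserve the property that the coordinates are
   algebraic up to a common factor. The center has the coordinates (-5/4 cos 1 : -5/4 sin 1 : 3/2);
   if it were constructible, exp i would be algebraic, which is refuted by Hermite's argument for the
   transcendence of e, carried out with Gaussian integers. *)

theory Submission
  imports Defs
begin

section \<open>Sums and products of algebraic numbers\<close>

text \<open>The map \<open>(x, y) -> (1/x, y/x)\<close> is projective and preserves
  \<open>k0\<close>: it interchanges the constant term and the coefficient of \<open>x^2\<close> in
  the equation \<open>x^2 - 3 x + y^2 + 1 = 0\<close>, and these agree. It does not fix the center,
  which goes to \<open>(2/3, 0)\<close>. Straightedge steps see only incidences, so they may be
  followed in the transformed picture, where the given points are rational points of the circle and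
  the point to be constructed is no longer its center. This is what makes the rotation effective: it
  would leave the center alone, but it gives an off-center rational point transcendental
  coordinates. Rational coordinates are not an invariant, because meeting a line with the circle
  requires a square root; algebraic ones are. The closure of algebraic numbers under field
  operations is needed over the reals for the geometry and over the complex numbers to pass from
  \<open>cos 1\<close> and \<open>sin 1\<close> to \<open>exp \<i>\<close>. Density of the given
  points is no obstacle, since limits are not construction steps.\<close>

interpretation rat: vector_space "\<lambda>q x. of_rat q * x :: 'a :: field_char_0"
  by unfold_locales (simp_all add: algebra_simps of_rat_add of_rat_mult)

lemma mult_in_rat_span:
  fixes x :: "'a :: field_char_0"
  assumes "v \<in> rat.span B" and x: "\<And>b. b \<in> B \<Longrightarrow> x * b \<in> rat.span C"
  shows "x * v \<in> rat.span C"
  using assms(1)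
proof (induction rule: rat.span_induct_alt)
  case (step c b v)
  have "x * (of_rat c * b + v) = of_rat c * (x * b) + x * v"
    by (simp add: algebra_simps)
  then show ?case
    using step x by (simp add: rat.span_add rat.span_scale)
qed (simp add: rat.span_zero)

text \<open>All powers of \<open>x\<close> stay in a space of dimension at most
  \<open>card B\<close>, so \<open>card B + 1\<close> of them satisfy a linear relation over the
  rationals, which is a polynomial equation for \<open>x\<close>.\<close>

lemma algebraic_if_finite_invariant:
  fixes x :: "'a :: field_char_0"
  assumes fin: "finite B" and one: "1 \<in> rat.span B"
    and inv: "\<And>b. b \<in> B \<Longrightarrow> x * b \<in> rat.span B"
  shows "algebraic x"
proof -
  have pow: "x ^ k \<in> rat.span B" for k
    by (induction k) (simp_all add: one mult_in_rat_span[OF _ inv])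
  define n where "n = card B"
  show ?thesis
  \<comment> \<open>If two of the powers coincide, the set of powers may be too small for the
    dimension count; then \<open>X^i - X^j\<close> annihilates \<open>x\<close> directly.\<close>
  proof (cases "inj_on (\<lambda>k. x ^ k) {..n}")
    case True
    let ?S = "(\<lambda>k. x ^ k) ` {..n}"
    have "card ?S = Suc n"
      using True by (simp add: card_image)
    moreover have "?S \<subseteq> rat.span B"
      using pow by blast
    ultimately have "rat.dependent ?S"
      using rat.independent_span_bound[OF fin, of ?S] n_def by force
    then obtain u where u: "\<exists>v\<in>?S. u v \<noteq> 0" "(\<Sum>v\<in>?S. of_rat (u v) * v) = 0"
      using rat.dependent_finite[of ?S] by auto
    define p :: "'a poly" where "p = (\<Sum>k\<le>n. monom (of_rat (u (x ^ k))) k)"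
    have coeff: "coeff p k = (if k \<le> n then of_rat (u (x ^ k)) else 0)" for k
      by (simp add: p_def coeff_sum sum.delta)
    have "poly p x = (\<Sum>k\<le>n. of_rat (u (x ^ k)) * x ^ k)"
      by (simp add: p_def poly_sum poly_monom)
    also have "\<dots> = (\<Sum>v\<in>?S. of_rat (u v) * v)"
      using True by (simp add: sum.reindex)
    finally have "poly p x = 0"
      using u(2) by simp
    moreover obtain k where "k \<le> n" "u (x ^ k) \<noteq> 0"
      using u(1) by auto
    then have "p \<noteq> 0"
      using coeff[of k] by auto
    ultimately show ?thesis
      using coeff by (intro algebraicI'[of p]) auto
  next
    case False
    then obtain i j where ij: "x ^ i = x ^ j" "i \<noteq> j"
      by (auto simp: inj_on_def)
    let ?p = "monom 1 i - monom 1 j :: 'a poly"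
    have "coeff ?p i = 1"
      using ij by simp
    then have "?p \<noteq> 0"
      by (metis coeff_0 zero_neq_one)
    then show ?thesis
      using ij by (intro algebraicI'[of ?p]) (auto simp: poly_monom)
  qed
qed

lemma algebraic_power_in_span:
  assumes "algebraic x"
  obtains m where "x ^ m \<in> rat.span ((\<lambda>i. x ^ i) ` {..<m})"
proof -
  obtain p where p: "p \<noteq> 0" "poly (map_poly of_int p) x = 0"
    using assms by (rule algebraicE')
  define m where "m = degree p"
  define c where "c = lead_coeff p"
  have c: "c \<noteq> 0"
    using p by (simp add: c_def)
  have "degree (map_poly of_int p :: 'a poly) = m"
    by (simp add: m_def degree_map_poly)
  then have "(\<Sum>i\<le>m. of_int (coeff p i) * x ^ i) = 0"
    using p(2) by (simp add: poly_altdef coeff_map_poly)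
  then have "of_int c * x ^ m = - (\<Sum>i<m. of_int (coeff p i) * x ^ i)"
    by (simp add: lessThan_Suc_atMost[symmetric] c_def m_def eq_neg_iff_add_eq_0 add.commute)
  then have "x ^ m = - (\<Sum>i<m. of_int (coeff p i) * x ^ i) / of_int c"
    using c by (metis nonzero_mult_div_cancel_left of_int_eq_0_iff)
  also have "\<dots> = (\<Sum>i<m. - of_int (coeff p i) / of_int c * x ^ i)"
    by (simp add: sum_divide_distrib sum_negf)
  also have "\<dots> = (\<Sum>i<m. of_rat (- of_int (coeff p i) / of_int c) * x ^ i)"
    by (simp add: of_rat_divide of_rat_minus)
  also have "\<dots> \<in> rat.span ((\<lambda>i. x ^ i) ` {..<m})"
    by (intro rat.span_sum rat.span_scale rat.span_base) auto
  finally show ?thesis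
    by (rule that)
qed

text \<open>The monomials \<open>x^i * y^j\<close> with \<open>i < m\<close> and
  \<open>j < n\<close> span a space stable under multiplication by \<open>x\<close> and by
  \<open>y\<close>, because \<open>x^m\<close> and \<open>y^n\<close> reduce to lower powers. Hence
  it is stable under \<open>x + y\<close> and \<open>x * y\<close> too.\<close>

lemma algebraic_add_mult:
  assumes "algebraic x" "algebraic y"
  shows "algebraic (x + y)" and "algebraic (x * y)"
proof -
  obtain m where m: "x ^ m \<in> rat.span ((\<lambda>i. x ^ i) ` {..<m})"
    using assms(1) by (rule algebraic_power_in_span)
  obtain n where n: "y ^ n \<in> rat.span ((\<lambda>i. y ^ i) ` {..<n})"
    using assms(2) by (rule algebraic_power_in_span)
  define B where "B = (\<lambda>(i, j). x ^ i * y ^ j) ` ({..<m} \<times> {..<n})"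
  have fin: "finite B"
    by (simp add: B_def)
  have B: "x ^ i * y ^ j \<in> rat.span B" if "i < m" "j < n" for i j
    using that by (intro rat.span_base) (auto simp: B_def)
  have Bx: "x ^ i * y ^ j \<in> rat.span B" if i: "i \<le> m" and j: "j < n" for i j
  proof (cases "i = m")
    case True
    have "y ^ j * x ^ m \<in> rat.span B"
      using m by (rule mult_in_rat_span) (use B j in \<open>auto simp: mult.commute\<close>)
    then show ?thesis
      using True by (simp add: mult.commute)
  qed (use i j B in auto)
  have By: "x ^ i * y ^ j \<in> rat.span B" if i: "i < m" and j: "j \<le> n" for i j
  proof (cases "j = n")
    case True
    have "x ^ i * y ^ n \<in> rat.span B"
      using n by (rule mult_in_rat_span) (use B i in auto)
    then show ?thesis
      using True by simp
  qed (use i j B in auto)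
  \<comment> \<open>For \<open>m = 0\<close> the span would be that of the empty set, which does not
    contain \<open>x^0 = 1\<close>.\<close>
  have pos: "0 < m" "0 < n"
    using m n by (auto intro!: Nat.gr0I)
  then have one: "1 \<in> rat.span B"
    using B[of 0 0] by simp
  have invx: "x * b \<in> rat.span B" if bB: "b \<in> B" for b
  proof -
    obtain i j where b: "b = x ^ i * y ^ j" "i < m" "j < n"
      using bB by (auto simp: B_def)
    then show ?thesis
      using Bx[of "Suc i" j] by (simp add: mult.assoc)
  qed
  have invy: "y * b \<in> rat.span B" if bB: "b \<in> B" for b
  proof -
    obtain i j where b: "b = x ^ i * y ^ j" "i < m" "j < n"
      using bB by (auto simp: B_def)
    then show ?thesis
      using By[of i "Suc j"] by (simp add: mult.left_commute)
  qed
  show "algebraic (x + y)"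
    using invx invy
    by (intro algebraic_if_finite_invariant[OF fin one]) (simp add: distrib_right rat.span_add)
  show "algebraic (x * y)"
    using mult_in_rat_span[OF invy invx]
    by (intro algebraic_if_finite_invariant[OF fin one]) (simp add: mult.assoc)
qed

lemma algebraic_diff: "algebraic x \<Longrightarrow> algebraic y \<Longrightarrow> algebraic (x - y)"
  using algebraic_add_mult(1)[of x "- y"] by simp

lemma algebraic_divide: "algebraic x \<Longrightarrow> algebraic y \<Longrightarrow> algebraic (x / y)"
  unfolding divide_inverse by (intro algebraic_add_mult algebraic_inverse)

lemma algebraic_power: "algebraic x \<Longrightarrow> algebraic (x ^ n)"
  by (induction n) (simp_all add: algebraic_add_mult)

lemmas algebraic_closed =
  algebraic_add_mult algebraic_diff algebraic_divide algebraic_power algebraic_minus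

section \<open>Transcendence of \<open>exp \<i>\<close>\<close>

lemma map_poly_of_int_higher_pderiv:
  "(pderiv ^^ j) (map_poly of_int p :: 'a :: {idom, ring_char_0} poly) = map_poly of_int ((pderiv ^^ j) p)"
proof (induction j)
  case (Suc j)
  have "pderiv (map_poly of_int q :: 'a poly) = map_poly of_int (pderiv q)" for q
    by (rule poly_eqI) (simp add: coeff_pderiv coeff_map_poly)
  then show ?case
    using Suc by simp
qed simp

lemma poly_map_poly_of_int: "poly (map_poly of_int p) (of_int x) = of_int (poly p x)"
  by (induction p) (simp_all add: map_poly_pCons)

text \<open>Taylor expansion at \<open>x\<close>. For integer polynomials it exhibits the factor
  \<open>fact j\<close>, the source of the divisibility by \<open>fact p\<close>, and it translates
  a root of high multiplicity into vanishing low coefficients.\<close>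

lemma poly_higher_pderiv_shift:
  fixes p :: "'a :: {idom, ring_char_0} poly"
  shows "poly ((pderiv ^^ j) p) x = fact j * coeff (p \<circ>\<^sub>p [:x, 1:]) j"
proof -
  have shift: "(pderiv ^^ j) (p \<circ>\<^sub>p [:x, 1:]) = (pderiv ^^ j) p \<circ>\<^sub>p [:x, 1:]"
    by (induction j) (simp_all add: pderiv_pcompose pderiv_pCons)
  have "poly ((pderiv ^^ j) p) x = poly ((pderiv ^^ j) p \<circ>\<^sub>p [:x, 1:]) 0"
    by (simp add: poly_pcompose)
  also have "\<dots> = coeff ((pderiv ^^ j) (p \<circ>\<^sub>p [:x, 1:])) 0"
    by (simp add: shift poly_0_coeff_0)
  finally show ?thesis
    by (simp add: coeff_higher_pderiv pochhammer_fact)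
qed

text \<open>This is the polynomial solution \<open>F\<close> of
  \<open>F' - \<i> F = - \<i> g\<close>, obtained by repeated integration by parts; the powers of
  \<open>- \<i>\<close> are those of \<open>1 / \<i>\<close>.\<close>

definition hermite_sum :: "complex poly \<Rightarrow> complex \<Rightarrow> complex" where
  "hermite_sum g z = (\<Sum>j\<le>degree g. (- \<i>) ^ j * poly ((pderiv ^^ j) g) z)"

lemma hermite_sum_deriv:
  "((\<lambda>z. exp (- \<i> * z) * hermite_sum g z) has_field_derivative
      - \<i> * exp (- \<i> * z) * poly g z) (at z within S)"
proof -
  define d where "d j = (- \<i>) ^ j * poly ((pderiv ^^ j) g) z" for j
  have "(hermite_sum g has_field_derivative
      (\<Sum>j\<le>degree g. (- \<i>) ^ j * poly ((pderiv ^^ Suc j) g) z)) (at z within S)"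
    unfolding hermite_sum_def funpow.simps o_def
    by (intro DERIV_sum DERIV_cmult DERIV_subset[OF poly_DERIV subset_UNIV])
  then have D: "((\<lambda>z. exp (- \<i> * z) * hermite_sum g z) has_field_derivative
      exp (- \<i> * z) * (\<Sum>j\<le>degree g. (- \<i>) ^ j * poly ((pderiv ^^ Suc j) g) z)
      + exp (- \<i> * z) * (- \<i>) * hermite_sum g z) (at z within S)"
    by (auto intro!: derivative_eq_intros)
  \<comment> \<open>The derivative of order \<open>degree g + 1\<close> vanishes, so shifting the
    index of the sum loses only the term \<open>g\<close> itself.\<close>
  have "(pderiv ^^ Suc (degree g)) g = 0"
    by (simp add: pderiv_eq_0_iff degree_higher_pderiv)
  then have "d (Suc (degree g)) = 0"
    by (simp add: d_def)
  then have "(\<Sum>j\<le>degree g. d j) - (\<Sum>j\<le>degree g. d (Suc j)) = d 0"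
    by (simp add: sum_subtractf[symmetric] sum_telescope)
  moreover have "(\<Sum>j\<le>degree g. d (Suc j)) = - \<i> * (\<Sum>j\<le>degree g. (- \<i>) ^ j * poly ((pderiv ^^ Suc j) g) z)"
    by (simp add: d_def sum_distrib_left mult.assoc)
  moreover have "(\<Sum>j\<le>degree g. d j) = hermite_sum g z" "d 0 = poly g z"
    by (simp_all add: d_def hermite_sum_def)
  ultimately have eq: "hermite_sum g z
      = poly g z - \<i> * (\<Sum>j\<le>degree g. (- \<i>) ^ j * poly ((pderiv ^^ Suc j) g) z)"
    by (simp add: algebra_simps)
  have "exp (- \<i> * z) * (\<Sum>j\<le>degree g. (- \<i>) ^ j * poly ((pderiv ^^ Suc j) g) z)
      + exp (- \<i> * z) * (- \<i>) * hermite_sum g z = - \<i> * exp (- \<i> * z) * poly g z"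
  proof -
    have "e * S + e * (- \<i>) * (G - \<i> * S) = - \<i> * e * G + e * S * (1 + \<i> * \<i>)" for e S G
      by algebra
    then show ?thesis
      unfolding eq by simp
  qed
  with D show ?thesis
    by simp
qed

text \<open>On the real segment from 0 to \<open>k\<close> the exponentials have modulus 1, so
  \<open>exp (- \<i> * z) * hermite_sum g z\<close> has a derivative of modulus
  \<open>norm (poly g z)\<close>. The mean value inequality applies, and multiplication by
  \<open>exp (\<i> * k)\<close> does not change the norm.\<close>

lemma hermite_sum_bound:
  assumes k: "0 \<le> k" and B: "\<And>t. 0 \<le> t \<Longrightarrow> t \<le> k \<Longrightarrow> norm (poly g (of_real t)) \<le> B"
  shows "norm (hermite_sum g (of_real k) - exp (\<i> * of_real k) * hermite_sum g 0) \<le> B * k"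
proof -
  let ?S = "of_real ` {0..k} :: complex set"
  let ?h = "\<lambda>z. exp (- \<i> * z) * hermite_sum g z"
  have e: "norm (exp (\<i> * of_real t)) = 1" "norm (exp (- (\<i> * of_real t))) = 1" for t
    by (simp_all add: norm_exp_eq_Re)
  have "norm (?h (of_real k) - ?h 0) \<le> B * norm (of_real k - 0 :: complex)"
  proof (rule field_differentiable_bound[OF _ hermite_sum_deriv])
    show "convex ?S"
      by (intro convex_linear_image) (auto simp: linear_of_real bounded_linear.linear bounded_linear_of_real)
    show "norm (- \<i> * exp (- \<i> * z) * poly g z) \<le> B" if "z \<in> ?S" for z
      using that B e by (auto simp: norm_mult)
  qed (use k in auto)
  moreover have "hermite_sum g (of_real k) - exp (\<i> * of_real k) * hermite_sum g 0
      = exp (\<i> * of_real k) * (?h (of_real k) - ?h 0)"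
    by (simp add: algebra_simps exp_minus)
  ultimately show ?thesis
    using k e by (simp add: norm_mult)
qed

text \<open>Multiplication by \<open>\<i>\<close> or \<open>- \<i>\<close> only permutes real and
  imaginary parts up to sign, so both stay integral.\<close>

lemma i_power_times_minus_i_power: "\<exists>e :: int. Re (\<i> ^ m * (- \<i>) ^ j) = of_int e"
proof -
  have "Re (\<i> ^ m * (- \<i>) ^ j) \<in> \<int> \<and> Im (\<i> ^ m * (- \<i>) ^ j) \<in> \<int>"
  proof (induction j)
    case 0
    show ?case
      by (induction m) auto
  next
    case (Suc j)
    have "\<i> ^ m * (- \<i>) ^ Suc j = - \<i> * (\<i> ^ m * (- \<i>) ^ j)"
      by simp
    then show ?case
      using Suc by (simp del: times_complex.sel power_Suc add: times_complex.sel(1,2)[of "- \<i>"])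
  qed
  then show ?thesis
    by (auto elim!: Ints_cases)
qed

text \<open>Hermite's argument. Multiplying by \<open>\<i> ^ (p - 1)\<close> makes the one term that is not divisible
  by \<open>p!\<close> real, so that only real parts have to be considered.\<close>

lemma hermite_lower_bound:
  fixes a :: "nat \<Rightarrow> int" and n p :: nat
  defines "g \<equiv> [:0, 1:] ^ (p - 1) * (\<Prod>k=1..n. [:- int k, 1:]) ^ p"
  assumes p: "prime p" "p > n" "p > nat \<bar>a 0\<bar>" and a0: "a 0 \<noteq> 0"
  shows "fact (p - 1) \<le> norm (\<Sum>k\<le>n. of_int (a k) * hermite_sum (map_poly of_int g) (of_nat k))"
proof -
  define D where "D j k = poly ((pderiv ^^ j) g) (int k)" for j k
  define E where "E j = (\<Sum>k\<le>n. a k * D j k)" for j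
  define c where "c = (\<Prod>k=1..n. - int k) ^ p"
  have fact_p: "fact p = int p * fact (p - 1)"
    using p(1) by (simp add: fact_reduce prime_gt_0_nat)
  have D: "D j k = fact j * coeff (g \<circ>\<^sub>p [:int k, 1:]) j" for j k
    by (simp add: D_def poly_higher_pderiv_shift)
  have dvd_large: "fact p dvd D j k" if "p \<le> j" for j k
    unfolding D using that by (intro dvd_mult2 fact_dvd)
  \<comment> \<open>The number \<open>k\<close> is a root of \<open>g\<close> of multiplicity at
    least \<open>p\<close>: derivatives of order below \<open>p\<close> vanish there, and the others
    carry the factor \<open>fact j\<close>.\<close>
  have dvd_pos: "fact p dvd D j k" if k: "k \<in> {1..n}" for j k
  proof (cases "p \<le> j")
    case False
    have "(\<Prod>i=1..n. [:- int i, 1:]) = [:- int k, 1:] * (\<Prod>i\<in>{1..n} - {k}. [:- int i, 1:])"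
      using k by (intro prod.remove) auto
    then have "g = [:- int k, 1:] ^ p * ([:0, 1:] ^ (p - 1) * (\<Prod>i\<in>{1..n} - {k}. [:- int i, 1:]) ^ p)"
      (is "_ = _ * ?h")
      unfolding g_def by (simp only: power_mult_distrib mult_ac)
    moreover have "(q ^ m) \<circ>\<^sub>p r = (q \<circ>\<^sub>p r) ^ m" for q r :: "int poly" and m
      by (induction m) (simp_all add: pcompose_mult pcompose_1)
    ultimately have "g \<circ>\<^sub>p [:int k, 1:] = [:0, 1:] ^ p * (?h \<circ>\<^sub>p [:int k, 1:])"
      by (simp add: pcompose_mult pcompose_pCons)
    then have "g \<circ>\<^sub>p [:int k, 1:] = monom 1 p * (?h \<circ>\<^sub>p [:int k, 1:])"
      by (simp add: monom_altdef)
    then have "coeff (g \<circ>\<^sub>p [:int k, 1:]) j = 0"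
      using False by (simp add: coeff_monom_mult)
    then show ?thesis
      by (simp add: D)
  qed (rule dvd_large)
  \<comment> \<open>At 0 the multiplicity is only \<open>p - 1\<close>, so exactly one order escapes
    the divisibility by \<open>fact p\<close>: the derivative of order \<open>p - 1\<close> has the
    value \<open>fact (p - 1) * c\<close>, where \<open>c\<close> is the \<open>p\<close>-th power
    of \<open>n!\<close> up to sign.\<close>
  have g0: "g \<circ>\<^sub>p [:int 0, 1:] = monom 1 (p - 1) * (\<Prod>k=1..n. [:- int k, 1:]) ^ p"
    by (simp add: g_def monom_altdef pcompose_idR)
  have c: "coeff ((\<Prod>k=1..n. [:- int k, 1:]) ^ p) 0 = c"
    unfolding c_def poly_0_coeff_0[symmetric] by (simp add: poly_power poly_prod)
  have D0: "D (p - 1) 0 = fact (p - 1) * c"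
    unfolding D g0 using c by (simp add: coeff_monom_mult)
  have dvd_0: "fact p dvd D j 0" if "j \<noteq> p - 1" for j
  proof (cases "p \<le> j")
    case False
    then have "D j 0 = 0"
      unfolding D g0 using that by (simp add: coeff_monom_mult)
    then show ?thesis
      by simp
  qed (rule dvd_large)
  have E: "fact p dvd E j" if "j \<noteq> p - 1" for j
    unfolding E_def
  proof (intro dvd_sum dvd_mult)
    fix k assume "k \<in> {..n}"
    then show "fact p dvd D j k"
      using dvd_pos[of k j] dvd_0[OF that] by (cases "k = 0") auto
  qed
  have E': "fact p dvd E (p - 1) - fact (p - 1) * (a 0 * c)"
  proof -
    have "E (p - 1) = a 0 * D (p - 1) 0 + (\<Sum>k=1..n. a k * D (p - 1) k)"
      by (simp add: E_def atMost_atLeast0 sum.atLeast_Suc_atMost)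
    moreover have "fact p dvd (\<Sum>k=1..n. a k * D (p - 1) k)"
      by (intro dvd_sum dvd_mult dvd_pos)
    ultimately show ?thesis
      unfolding D0 by (simp add: mult_ac)
  qed
  have not_dvd: "\<not> int p dvd a 0 * c"
  proof
    assume "int p dvd a 0 * c"
    moreover have "prime (int p)"
      using p(1) by simp
    moreover have "\<not> int p dvd a 0"
      using a0 p(3) zdvd_imp_le[of "int p" "\<bar>a 0\<bar>"] by auto
    ultimately have "int p dvd (\<Prod>k=1..n. - int k)"
      unfolding c_def using prime_dvd_mult_iff prime_dvd_power by blast
    then obtain k where "k \<in> {1..n}" "int p dvd - int k"
      using \<open>prime (int p)\<close> by (auto simp: prime_dvd_prod_iff)
    then show False
      using p(2) by (auto dest: dvd_imp_le)
  qed
  \<comment> \<open>These integers are the real parts left after the multiplication by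
    \<open>\<i> ^ (p - 1)\<close>. The exceptional order \<open>p - 1\<close> receives the weight
    1.\<close>
  define e where "e j = (SOME e :: int. Re (\<i> ^ (p - 1) * (- \<i>) ^ j) = of_int e)" for j
  have e: "Re (\<i> ^ (p - 1) * (- \<i>) ^ j) = of_int (e j)" for j
    unfolding e_def using i_power_times_minus_i_power by (rule someI_ex)
  have "\<i> ^ (p - 1) * (- \<i>) ^ (p - 1) = 1"
    by (simp flip: power_mult_distrib)
  then have e1: "e (p - 1) = 1"
    using e[of "p - 1"] by simp
  let ?G = "map_poly of_int g :: complex poly"
  let ?T = "\<Sum>k\<le>n. of_int (a k) * hermite_sum ?G (of_nat k)"
  have deg: "degree ?G = degree g"
    by (simp add: degree_map_poly)
  have "poly ((pderiv ^^ j) ?G) (of_nat k) = of_int (D j k)" for j k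
    unfolding D_def map_poly_of_int_higher_pderiv
    using poly_map_poly_of_int[of _ "int k"] by simp
  then have "?T = (\<Sum>k\<le>n. \<Sum>j\<le>degree g. (- \<i>) ^ j * of_int (a k * D j k))"
    by (simp add: hermite_sum_def deg sum_distrib_left mult_ac)
  also have "\<dots> = (\<Sum>j\<le>degree g. (- \<i>) ^ j * of_int (E j))"
    unfolding E_def of_int_sum sum_distrib_left by (rule sum.swap)
  finally have "\<i> ^ (p - 1) * ?T = (\<Sum>j\<le>degree g. (\<i> ^ (p - 1) * (- \<i>) ^ j) * of_int (E j))"
    by (simp add: sum_distrib_left mult_ac)
  moreover have "Re (\<i> ^ (p - 1) * (- \<i>) ^ j * of_int (E j)) = of_int (e j * E j)" for j
    unfolding of_int_mult e[symmetric] by simp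
  ultimately have Re: "Re (\<i> ^ (p - 1) * ?T) = of_int (\<Sum>j\<le>degree g. e j * E j)"
    by (simp only: Re_sum of_int_sum)
  define N where "N = (\<Sum>j\<le>degree g. e j * E j)"
  \<comment> \<open>This ensures that the exceptional term really occurs in the sum.\<close>
  have "p - 1 \<le> degree g"
  proof (rule le_degree)
    have "coeff g (p - 1) = c"
      using g0 c by (simp add: coeff_monom_mult)
    then show "coeff g (p - 1) \<noteq> 0"
      using not_dvd by auto
  qed
  then have "N = E (p - 1) + (\<Sum>j\<in>{..degree g} - {p - 1}. e j * E j)"
    unfolding N_def by (subst sum.remove[of _ "p - 1"]) (use e1 in auto)
  moreover have "fact p dvd (\<Sum>j\<in>{..degree g} - {p - 1}. e j * E j)"
    using E by (intro dvd_sum dvd_mult) auto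
  ultimately have "fact p dvd N - fact (p - 1) * (a 0 * c)"
    using dvd_add[OF E'] by (simp only: diff_add_eq)
  then obtain q where "N - fact (p - 1) * (a 0 * c) = fact p * q"
    by (rule dvdE)
  then have N: "N = fact (p - 1) * (a 0 * c + int p * q)"
    unfolding fact_p by (simp only: diff_eq_eq distrib_left mult_ac add_ac)
  \<comment> \<open>The number \<open>N\<close> is \<open>fact (p - 1)\<close> times an integer;
    that integer is nonzero because it is not divisible by \<open>p\<close>.\<close>
  have "a 0 * c + int p * q \<noteq> 0"
  proof
    assume "a 0 * c + int p * q = 0"
    then have "a 0 * c = int p * (- q)"
      by linarith
    then show False
      using not_dvd by simp
  qed
  then have "1 \<le> \<bar>a 0 * c + int p * q\<bar>"
    by linarith
  then have "fact (p - 1) \<le> \<bar>N\<bar>"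
    unfolding N abs_mult by (simp add: mult_le_cancel_left1)
  then have "fact (p - 1) \<le> \<bar>Re (\<i> ^ (p - 1) * ?T)\<bar>"
    unfolding Re N_def[symmetric] by (metis of_int_abs of_int_fact of_int_le_iff)
  also have "\<dots> \<le> norm (\<i> ^ (p - 1) * ?T)"
    by (rule abs_Re_le_cmod)
  also have "\<dots> = norm ?T"
    by (simp add: norm_mult norm_power)
  finally show ?thesis .
qed

text \<open>On \<open>[0, n]\<close> every linear factor has modulus at most \<open>n\<close>.
  Raising the exponent \<open>p - 1\<close> to \<open>p\<close>, possible as
  \<open>n \<ge> 1\<close>, makes the bound a pure \<open>p\<close>-th power.\<close>

lemma hermite_poly_bound:
  fixes n p :: nat and t :: real
  defines "g \<equiv> [:0, 1:] ^ (p - 1) * (\<Prod>k=1..n. [:- int k, 1:]) ^ p"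
  assumes t: "0 \<le> t" "t \<le> n" and n: "n \<ge> 1"
  shows "norm (poly (map_poly of_int g) (of_real t :: complex)) \<le> (real n ^ Suc n) ^ p"
proof -
  have mult: "map_poly of_int (u * v) = (map_poly of_int u * map_poly of_int v :: complex poly)" for u v
    by (rule poly_eqI) (simp add: coeff_map_poly coeff_mult)
  have power: "map_poly of_int (u ^ m) = (map_poly of_int u ^ m :: complex poly)" for u m
    by (induction m) (simp_all add: mult)
  have prod: "map_poly of_int (\<Prod>k=1..m. u k) = (\<Prod>k=1..m. map_poly of_int (u k) :: complex poly)"
    for u :: "nat \<Rightarrow> int poly" and m
    by (induction m) (simp_all add: mult)
  have "norm (poly (map_poly of_int g) (of_real t :: complex))
      = norm (complex_of_real (t ^ (p - 1) * (\<Prod>k=1..n. t - real k) ^ p))"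
    unfolding g_def mult power prod
    by (simp add: poly_power poly_prod map_poly_pCons algebra_simps)
  also have "\<dots> = t ^ (p - 1) * (\<Prod>k=1..n. \<bar>t - real k\<bar>) ^ p"
    using t by (simp only: norm_of_real abs_mult power_abs abs_prod abs_of_nonneg)
  also have "\<dots> \<le> real n ^ p * (real n ^ n) ^ p"
  proof (intro mult_mono power_mono)
    have "t ^ (p - 1) \<le> real n ^ (p - 1)"
      using t by (intro power_mono)
    also have "\<dots> \<le> real n ^ p"
      using n by (intro power_increasing) auto
    finally show "t ^ (p - 1) \<le> real n ^ p" .
    have "(\<Prod>k=1..n. \<bar>t - real k\<bar>) \<le> (\<Prod>k=1..n. real n)"
      using t by (intro prod_mono) auto
    then show "(\<Prod>k=1..n. \<bar>t - real k\<bar>) \<le> real n ^ n"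
      by simp
  qed (use t in \<open>auto intro!: prod_nonneg zero_le_power\<close>)
  also have "\<dots> = (real n ^ Suc n) ^ p"
    by (simp add: power_mult_distrib)
  finally show ?thesis .
qed

text \<open>An integer relation between the powers of \<open>exp \<i>\<close> cancels the
  contributions of \<open>hermite_sum\<close> at 0, leaving only the small differences of
  \<open>hermite_sum_bound\<close>. They grow like \<open>R ^ p\<close>, against the lower bound
  \<open>fact (p - 1)\<close>.\<close>

theorem not_algebraic_exp_i: "\<not> algebraic (exp \<i>)"
proof
  assume "algebraic (exp \<i>)"
  \<comment> \<open>The constant coefficient can be made nonzero because \<open>exp \<i>\<close> is
    nonzero; it becomes \<open>a 0\<close> in the lower bound.\<close>
  then obtain P where P: "coeff P 0 \<noteq> 0" "poly (map_poly of_int P) (exp \<i>) = 0"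
    by (rule algebraicE'_nonzero) simp_all
  define a where "a = coeff P"
  define n where "n = degree P"
  have "degree (map_poly of_int P :: complex poly) = n"
    by (simp add: n_def degree_map_poly)
  then have rel: "(\<Sum>k\<le>n. of_int (a k) * exp (\<i> * of_nat k)) = 0"
    using P(2) by (simp add: a_def poly_altdef coeff_map_poly exp_of_nat_mult[symmetric] mult.commute)
  then have n: "n \<ge> 1"
    using P(1) by (cases n) (auto simp: a_def)
  define C where "C = (\<Sum>k\<le>n. \<bar>real_of_int (a k)\<bar>) * n"
  define R where "R = real n ^ Suc n"
  have bound: "fact (p - 1) \<le> C * R ^ p" if p: "prime p" "p > n" "p > nat \<bar>a 0\<bar>" for p
  proof -
    define g where "g = [:0, 1:] ^ (p - 1) * (\<Prod>k=1..n. [:- int k, 1:]) ^ p"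
    let ?F = "hermite_sum (map_poly of_int g)"
    have "fact (p - 1) \<le> norm (\<Sum>k\<le>n. of_int (a k) * ?F (of_nat k))"
      unfolding g_def using p P(1) by (intro hermite_lower_bound) (auto simp: a_def)
    also have "(\<Sum>k\<le>n. of_int (a k) * ?F (of_nat k))
        = (\<Sum>k\<le>n. of_int (a k) * (?F (of_nat k) - exp (\<i> * of_nat k) * ?F 0))"
    proof -
      have "(\<Sum>k\<le>n. of_int (a k) * (exp (\<i> * of_nat k) * ?F 0)) = 0"
        using rel by (simp add: sum_distrib_right[symmetric] mult.assoc[symmetric])
      then show ?thesis
        by (simp add: right_diff_distrib sum_subtractf)
    qed
    also have "norm \<dots> \<le> (\<Sum>k\<le>n. \<bar>real_of_int (a k)\<bar> * (R ^ p * n))"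
    proof (rule sum_norm_le)
      fix k assume k: "k \<in> {..n}"
      have "norm (?F (of_real (real k)) - exp (\<i> * of_real (real k)) * ?F 0) \<le> R ^ p * real k"
        unfolding g_def R_def using k n by (intro hermite_sum_bound hermite_poly_bound) auto
      also have "\<dots> \<le> R ^ p * n"
        using k by (intro mult_left_mono) (auto simp: R_def)
      finally show "norm (of_int (a k) * (?F (of_nat k) - exp (\<i> * of_nat k) * ?F 0))
          \<le> \<bar>real_of_int (a k)\<bar> * (R ^ p * n)"
        by (simp add: norm_mult mult_left_mono)
    qed
    also have "\<dots> = C * R ^ p"
      by (simp add: C_def sum_distrib_left mult_ac)
    finally show ?thesis .
  qed
  have "(\<lambda>m. R ^ m / fact m) \<longlonglongrightarrow> 0"
    using summable_LIMSEQ_zero[OF summable_exp[of R]] by (simp add: field_simps)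
  \<comment> \<open>Here \<open>m\<close> stands for \<open>p - 1\<close>; the additional factor
    \<open>R\<close> turns \<open>R ^ (p - 1)\<close> into \<open>R ^ p\<close>.\<close>
  then have "(\<lambda>m. C * R * (R ^ m / fact m)) \<longlonglongrightarrow> C * R * 0"
    by (intro tendsto_mult tendsto_const)
  then have "eventually (\<lambda>m. C * R * (R ^ m / fact m) < 1) sequentially"
    by (rule order_tendstoD) simp
  then obtain m0 where m0: "\<And>m. m \<ge> m0 \<Longrightarrow> C * R * (R ^ m / fact m) < 1"
    by (auto simp: eventually_sequentially)
  obtain p where p: "prime p" "p > n + nat \<bar>a 0\<bar> + m0 + 1"
    using bigger_prime by blast
  then have "C * R * (R ^ (p - 1) / fact (p - 1)) < 1"
    by (intro m0) simp
  moreover have "R ^ p = R * R ^ (p - 1)"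
    using p(2) by (cases p) auto
  ultimately have "C * R ^ p < fact (p - 1)"
    by (simp add: field_simps)
  with bound[of p] p show False
    by simp
qed

section \<open>Points and lines with algebraic homogeneous coordinates\<close>

text \<open>Undoing \<open>(x, y) -> (1/x, y/x)\<close>, which is an involution, and subtracting the
  center gives \<open>(1/x - 3/2, y/x)\<close>. Multiplication by \<open>x\<close> clears the
  denominators, and a rotation by \<open>+1\<close> undoes that of \<open>pt\<close>. Points with
  \<open>fst z = 0\<close> get the coordinates of points at infinity.\<close>

definition h1 :: "point \<Rightarrow> real" where
  "h1 z = (1 - 3/2 * fst z) * cos 1 - snd z * sin 1"

definition h2 :: "point \<Rightarrow> real" where
  "h2 z = (1 - 3/2 * fst z) * sin 1 + snd z * cos 1"

definition h3 :: "point \<Rightarrow> real" where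
  "h3 z = fst z"

text \<open>The scale \<open>l\<close> is any nonzero real, possibly transcendental: only the ratios
  of homogeneous coordinates matter.\<close>

definition alg_point :: "point \<Rightarrow> bool" where
  "alg_point z \<longleftrightarrow>
     (\<exists>l. l \<noteq> 0 \<and> algebraic (l * h1 z) \<and> algebraic (l * h2 z) \<and> algebraic (l * h3 z))"

definition alg_line :: "point set \<Rightarrow> bool" where
  "alg_line L \<longleftrightarrow>
     (\<exists>a b c. algebraic a \<and> algebraic b \<and> algebraic c \<and> (a \<noteq> 0 \<or> b \<noteq> 0 \<or> c \<noteq> 0) \<and>
        L = {z. a * h1 z + b * h2 z + c * h3 z = 0})"

lemma sum_squares_h: "(h1 z)\<^sup>2 + (h2 z)\<^sup>2 = (1 - 3/2 * fst z)\<^sup>2 + (snd z)\<^sup>2"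
proof -
  have "(h1 z)\<^sup>2 + (h2 z)\<^sup>2 = ((1 - 3/2 * fst z)\<^sup>2 + (snd z)\<^sup>2) * ((sin 1)\<^sup>2 + (cos 1)\<^sup>2)"
    unfolding h1_def h2_def by algebra
  then show ?thesis
    by simp
qed

lemma h_nonzero: "h1 z \<noteq> 0 \<or> h2 z \<noteq> 0 \<or> h3 z \<noteq> 0"
proof (rule ccontr)
  assume "\<not> ?thesis"
  then have "(h1 z)\<^sup>2 + (h2 z)\<^sup>2 = 0" "fst z = 0"
    by (simp_all add: h3_def)
  then have "1 + (snd z)\<^sup>2 = 0"
    using sum_squares_h[of z] by simp
  then show False
    by (smt (verit) zero_le_power2)
qed

text \<open>The line \<open>x = 0\<close>, which goes to infinity, misses \<open>k0\<close> because
  the center has distance \<open>3/2 > sqrt (5/4)\<close> from it. Thus \<open>h3\<close> may serve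
  as a divisor on \<open>k0\<close>.\<close>

lemma k0_h:
  assumes "z \<in> k0"
  shows "(h1 z)\<^sup>2 + (h2 z)\<^sup>2 = 5/4 * (h3 z)\<^sup>2" and "h3 z \<noteq> 0"
proof -
  have k: "(fst z - 3/2)\<^sup>2 + (snd z)\<^sup>2 = 5/4"
    using assms by (auto simp: k0_def)
  then have "(1 - 3/2 * fst z)\<^sup>2 + (snd z)\<^sup>2 = 5/4 * (fst z)\<^sup>2"
    by (simp add: power2_eq_square algebra_simps)
  then show "(h1 z)\<^sup>2 + (h2 z)\<^sup>2 = 5/4 * (h3 z)\<^sup>2"
    by (simp add: sum_squares_h h3_def)
  show "h3 z \<noteq> 0"
  proof
    assume "h3 z = 0"
    then have "(snd z)\<^sup>2 = 5/4 - (3/2)\<^sup>2"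
      using k by (simp add: h3_def)
    also have "\<dots> < 0"
      by (simp add: power2_eq_square)
    finally show False
      using zero_le_power2[of "snd z"] by linarith
  qed
qed

text \<open>The triple \<open>(h1, h2, h3)\<close> is a linear image of \<open>(1, x, y)\<close>
  with determinant \<open>-1\<close>, so the triple product of three points is, up to sign, the
  usual collinearity determinant.\<close>

lemma det_h:
  "(h2 p * h3 q - h3 p * h2 q) * h1 z + (h3 p * h1 q - h1 p * h3 q) * h2 z
     + (h1 p * h2 q - h2 p * h1 q) * h3 z
   = (snd q - snd p) * (fst z - fst p) - (fst q - fst p) * (snd z - snd p)"
proof -
  have "(h2 p * h3 q - h3 p * h2 q) * h1 z + (h3 p * h1 q - h1 p * h3 q) * h2 z
     + (h1 p * h2 q - h2 p * h1 q) * h3 z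
   = ((snd q - snd p) * (fst z - fst p) - (fst q - fst p) * (snd z - snd p)) * ((sin 1)\<^sup>2 + (cos 1)\<^sup>2)"
    unfolding h1_def h2_def h3_def by algebra
  then show ?thesis
    by simp
qed

lemma mem_line_through_iff:
  assumes "p \<noteq> q"
  shows "z \<in> line_through p q \<longleftrightarrow>
    (snd q - snd p) * (fst z - fst p) = (fst q - fst p) * (snd z - snd p)" (is "_ \<longleftrightarrow> ?eq")
proof
  assume "z \<in> line_through p q"
  then obtain u v where "z = u *\<^sub>R p + v *\<^sub>R q" and uv: "u + v = 1"
    by (auto simp: line_through_def affine_hull_2)
  then have "fst z = u * fst p + v * fst q" "snd z = u * snd p + v * snd q"
    by simp_all
  then show ?eq
    using uv by algebra
next
  assume eq: ?eq
  have "\<exists>t. fst z = fst p + t * (fst q - fst p) \<and> snd z = snd p + t * (snd q - snd p)"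
  proof (cases "fst q = fst p")
    case True
    then have "snd q \<noteq> snd p"
      using assms by (auto simp: prod_eq_iff)
    then show ?thesis
      using True eq by (intro exI[of _ "(snd z - snd p) / (snd q - snd p)"]) auto
  next
    case False
    then show ?thesis
      using eq by (intro exI[of _ "(fst z - fst p) / (fst q - fst p)"]) (auto simp: field_simps)
  qed
  then obtain t where "fst z = fst p + t * (fst q - fst p)" "snd z = snd p + t * (snd q - snd p)"
    by blast
  then have "z = (1 - t) *\<^sub>R p + t *\<^sub>R q"
    by (simp add: prod_eq_iff algebra_simps)
  then show "z \<in> line_through p q"
    unfolding line_through_def affine_hull_2 by (intro CollectI exI[of _ "1 - t"] exI[of _ t]) simp
qed

text \<open>The coefficients of the joining line are the cross product of the scaled coordinate
  vectors.\<close>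

lemma alg_line_line_through:
  assumes p: "alg_point p" and q: "alg_point q" and "p \<noteq> q"
  shows "alg_line (line_through p q)"
proof -
  obtain l where l: "l \<noteq> 0" "algebraic (l * h1 p)" "algebraic (l * h2 p)" "algebraic (l * h3 p)"
    using p by (auto simp: alg_point_def)
  obtain m where m: "m \<noteq> 0" "algebraic (m * h1 q)" "algebraic (m * h2 q)" "algebraic (m * h3 q)"
    using q by (auto simp: alg_point_def)
  define a where "a = (l * h2 p) * (m * h3 q) - (l * h3 p) * (m * h2 q)"
  define b where "b = (l * h3 p) * (m * h1 q) - (l * h1 p) * (m * h3 q)"
  define c where "c = (l * h1 p) * (m * h2 q) - (l * h2 p) * (m * h1 q)"
  have det: "a * h1 z + b * h2 z + c * h3 z
      = l * m * ((snd q - snd p) * (fst z - fst p) - (fst q - fst p) * (snd z - snd p))" for z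
    unfolding det_h[symmetric] a_def b_def c_def by (simp add: algebra_simps)
  have "algebraic a" "algebraic b" "algebraic c"
    unfolding a_def b_def c_def using l m by (auto intro!: algebraic_closed)
  moreover have "a \<noteq> 0 \<or> b \<noteq> 0 \<or> c \<noteq> 0"
  proof (rule ccontr)
    \<comment> \<open>This is \<open>p\<close> plus \<open>q - p\<close> turned by a right angle. It
      lies off the line, and the determinant there is the squared distance of \<open>p\<close> and
      \<open>q\<close>.\<close>
    let ?z = "(fst p + (snd q - snd p), snd p - (fst q - fst p))"
    assume "\<not> ?thesis"
    then have "l * m * ((snd q - snd p)\<^sup>2 + (fst q - fst p)\<^sup>2) = 0"
      using det[of ?z] by (simp add: power2_eq_square algebra_simps)
    then have "(snd q - snd p)\<^sup>2 + (fst q - fst p)\<^sup>2 = 0"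
      using l m by simp
    then show False
      using \<open>p \<noteq> q\<close> by (simp add: sum_power2_eq_zero_iff prod_eq_iff)
  qed
  moreover have "line_through p q = {z. a * h1 z + b * h2 z + c * h3 z = 0}"
    unfolding det using l m mem_line_through_iff[OF \<open>p \<noteq> q\<close>] by auto
  ultimately show ?thesis
    unfolding alg_line_def by blast
qed

text \<open>Both coefficient vectors are orthogonal to \<open>(x, y, z)\<close>, so their cross
  product is parallel to it; the factor \<open>l\<close> may vanish.\<close>

lemma cross_product_parallel:
  fixes a b c a' b' c' x y z :: "'a :: field"
  assumes "x \<noteq> 0 \<or> y \<noteq> 0 \<or> z \<noteq> 0"
    and "a * x + b * y + c * z = 0" "a' * x + b' * y + c' * z = 0"
  obtains l where "b * c' - c * b' = l * x" "c * a' - a * c' = l * y" "a * b' - b * a' = l * z"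
proof -
  define u v w where "u = b * c' - c * b'" and "v = c * a' - a * c'" and "w = a * b' - b * a'"
  have "u * y = v * x" "v * z = w * y" "u * z = w * x"
    unfolding u_def v_def w_def using assms(2,3) by algebra+
  then have "\<exists>l. u = l * x \<and> v = l * y \<and> w = l * z"
    using assms(1)
    by (metis mult.commute mult.assoc nonzero_mult_div_cancel_right times_divide_eq_left)
  then show ?thesis
    using that unfolding u_def v_def w_def by blast
qed

text \<open>Dually to joining, the intersection has the cross product of the coefficient vectors as
  coordinates. It is nonzero, since proportional coefficients would define the same line.\<close>

lemma alg_point_line_line:
  assumes L: "alg_line L" and M: "alg_line M" and "L \<noteq> M" and z: "z \<in> L" "z \<in> M"
  shows "alg_point z"
proof -
  obtain a b c where n: "algebraic a" "algebraic b" "algebraic c" "a \<noteq> 0 \<or> b \<noteq> 0 \<or> c \<noteq> 0"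
    and Leq: "L = {z. a * h1 z + b * h2 z + c * h3 z = 0}"
    using L by (auto simp: alg_line_def)
  obtain a' b' c' where n': "algebraic a'" "algebraic b'" "algebraic c'" "a' \<noteq> 0 \<or> b' \<noteq> 0 \<or> c' \<noteq> 0"
    and Meq: "M = {z. a' * h1 z + b' * h2 z + c' * h3 z = 0}"
    using M by (auto simp: alg_line_def)
  obtain l where l: "b * c' - c * b' = l * h1 z" "c * a' - a * c' = l * h2 z" "a * b' - b * a' = l * h3 z"
    using z Leq Meq by (auto intro: cross_product_parallel[OF h_nonzero[of z], of a b c a' b' c'])
  have "l \<noteq> 0"
  proof
    assume "l = 0"
    then have par: "b * c' = c * b'" "c * a' = a * c'" "a * b' = b * a'"
      using l by auto
    have "a * h1 w + b * h2 w + c * h3 w = 0 \<longleftrightarrow> a' * h1 w + b' * h2 w + c' * h3 w = 0" for w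
    proof -
      let ?s = "a * h1 w + b * h2 w + c * h3 w" and ?s' = "a' * h1 w + b' * h2 w + c' * h3 w"
      have "a * ?s' = a' * ?s" "b * ?s' = b' * ?s" "c * ?s' = c' * ?s"
        using par by algebra+
      then show ?thesis
        using n(4) n'(4) by force
    qed
    then show False
      using \<open>L \<noteq> M\<close> Leq Meq by auto
  qed
  moreover have "algebraic (l * h1 z)" "algebraic (l * h2 z)" "algebraic (l * h3 z)"
    unfolding l[symmetric] using n n' by (auto intro!: algebraic_closed)
  ultimately show ?thesis
    unfolding alg_point_def by blast
qed

lemma algebraic_if_square:
  fixes x :: real
  assumes "algebraic (x\<^sup>2)"
  shows "algebraic x"
  using algebraic_sqrt[OF assms] by simp

text \<open>A line \<open>a u + b v + c = 0\<close> meets the circle \<open>u\<^sup>2 + v\<^sup>2 = 5/4\<close> in points determined by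
  \<open>t = a v - b u\<close>, since \<open>t\<^sup>2 + c\<^sup>2 = (a\<^sup>2 + b\<^sup>2) (u\<^sup>2 + v\<^sup>2)\<close>.\<close>

lemma alg_point_line_circle:
  assumes L: "alg_line L" and z: "z \<in> L" "z \<in> k0"
  shows "alg_point z"
proof -
  obtain a b c where n: "algebraic a" "algebraic b" "algebraic c" "a \<noteq> 0 \<or> b \<noteq> 0 \<or> c \<noteq> 0"
    and eq: "a * h1 z + b * h2 z + c * h3 z = 0"
    using L z(1) by (auto simp: alg_line_def)
  define u v where "u = h1 z / h3 z" and "v = h2 z / h3 z"
  note nz = k0_h(2)[OF z(2)]
  have circle: "u\<^sup>2 + v\<^sup>2 = 5/4"
    using k0_h(1)[OF z(2)] nz by (simp add: u_def v_def field_simps)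
  have line: "a * u + b * v + c = 0"
    using eq nz by (simp add: u_def v_def field_simps)
  define t where "t = a * v - b * u"
  \<comment> \<open>If \<open>a = b = 0\<close>, the equation \<open>line\<close> would force
    \<open>c = 0\<close> as well.\<close>
  have "a\<^sup>2 + b\<^sup>2 \<noteq> 0"
    using n(4) line by (auto simp: sum_power2_eq_zero_iff)
  moreover have "(a\<^sup>2 + b\<^sup>2) * u = - (a * c) - b * t" "(a\<^sup>2 + b\<^sup>2) * v = a * t - b * c"
    unfolding t_def using line by algebra+
  ultimately have uv: "u = (- (a * c) - b * t) / (a\<^sup>2 + b\<^sup>2)" "v = (a * t - b * c) / (a\<^sup>2 + b\<^sup>2)"
    by (simp_all add: eq_divide_eq mult.commute)
  have "t\<^sup>2 = (a\<^sup>2 + b\<^sup>2) * (u\<^sup>2 + v\<^sup>2) - c\<^sup>2"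
    unfolding t_def using line by algebra
  then have "algebraic (t\<^sup>2)"
    unfolding circle using n by (auto intro!: algebraic_closed)
  then have "algebraic t"
    by (rule algebraic_if_square)
  then have "algebraic u" "algebraic v"
    unfolding uv using n by (auto intro!: algebraic_closed)
  then show ?thesis
    unfolding alg_point_def using nz by (intro exI[of _ "1 / h3 z"]) (auto simp: u_def v_def)
qed

lemma not_alg_point_center: "\<not> alg_point c0"
proof
  assume "alg_point c0"
  then obtain l where l: "l \<noteq> 0" "algebraic (l * h1 c0)" "algebraic (l * h2 c0)" "algebraic (l * h3 c0)"
    by (auto simp: alg_point_def)
  \<comment> \<open>The scale cancels in the quotient \<open>h1 c0 / h3 c0 = - 5/6 * cos 1\<close>,
    and likewise for \<open>h2\<close> and \<open>sin 1\<close>; the factor \<open>- 6 / 5\<close>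
    removes the constant.\<close>
  have "algebraic ((l * h1 c0) / (l * h3 c0) * (- 6 / 5))" "algebraic ((l * h2 c0) / (l * h3 c0) * (- 6 / 5))"
    by (intro algebraic_add_mult(2) algebraic_divide l algebraic_minus algebraic_numeral)+
  then have "algebraic (cos 1 :: real)" "algebraic (sin 1 :: real)"
    using l(1) by (simp_all add: h1_def h2_def h3_def c0_def)
  then have "algebraic (complex_of_real (cos 1) + \<i> * complex_of_real (sin 1))"
    by (auto intro!: algebraic_closed)
  moreover have "exp \<i> = complex_of_real (cos 1) + \<i> * complex_of_real (sin 1)"
  proof -
    have "exp \<i> = cis 1"
      by (simp add: cis_conv_exp)
    then show ?thesis
      by (simp add: complex_eq_iff)
  qed
  ultimately show False
    using not_algebraic_exp_i by simp
qed

section \<open>The points of \<open>Y0\<close>\<close>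

lemma beta_gamma_denom_pos: "5 - 2 * \<alpha> + \<alpha>\<^sup>2 > (0 :: real)"
proof -
  have "5 - 2 * \<alpha> + \<alpha>\<^sup>2 = (\<alpha> - 1)\<^sup>2 + 4"
    by (simp add: power2_eq_square algebra_simps)
  then show ?thesis
    using zero_le_power2[of "\<alpha> - 1"] by linarith
qed

lemma beta_gamma_circle: "(beta \<alpha> - 3/2)\<^sup>2 + (gamma \<alpha>)\<^sup>2 = 5/4"
proof -
  define d where "d = 5 - 2 * \<alpha> + \<alpha>\<^sup>2"
  have d: "d \<noteq> 0"
    using beta_gamma_denom_pos[of \<alpha>] by (simp add: d_def)
  have "(beta \<alpha> - 3/2)\<^sup>2 + (gamma \<alpha>)\<^sup>2
      = (((2 + 2 * \<alpha>\<^sup>2) - 3/2 * d)\<^sup>2 + (1 + 4 * \<alpha> - \<alpha>\<^sup>2)\<^sup>2) / d\<^sup>2"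
    using d unfolding beta_def gamma_def d_def[symmetric] by (simp add: field_simps power2_eq_square)
  also have "((2 + 2 * \<alpha>\<^sup>2) - 3/2 * d)\<^sup>2 + (1 + 4 * \<alpha> - \<alpha>\<^sup>2)\<^sup>2 = 5/4 * d\<^sup>2"
    unfolding d_def by (simp add: field_simps power2_eq_square)
  finally show ?thesis
    using d by simp
qed

text \<open>This is \<open>pt\<close> with \<open>beta \<alpha>\<close> and
  \<open>gamma \<alpha>\<close> replaced by an arbitrary point of the circle, so that the rotation
  with the projective map can be studied apart from the rational parametrization.\<close>

definition circle_map :: "real \<Rightarrow> real \<Rightarrow> point" where
  "circle_map b g = (let d = (b - 3/2) * cos 1 + g * sin 1 + 3/2
     in (1 / d, ((3/2 - b) * sin 1 + g * cos 1) / d))"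

lemma pt_eq: "pt \<alpha> = circle_map (beta \<alpha>) (gamma \<alpha>)"
  by (simp add: pt_def circle_map_def Let_def)

text \<open>By Cauchy-Schwarz the first two terms sum to at most \<open>sqrt (5/4) < 3/2\<close> in
  absolute value; the proof uses the underlying identity of squares.\<close>

lemma circle_map_denom_nonzero:
  assumes "(b - 3/2)\<^sup>2 + g\<^sup>2 = 5/4"
  shows "(b - 3/2) * cos 1 + g * sin 1 + 3/2 \<noteq> (0 :: real)"
proof
  assume eq: "(b - 3/2) * cos 1 + g * sin 1 + 3/2 = 0"
  have "(b - 3/2) * cos 1 + g * sin 1 = - (3/2)"
    using eq by linarith
  then have sq: "((b - 3/2) * cos 1 + g * sin 1)\<^sup>2 = (3/2)\<^sup>2"
    by simp
  have "((b - 3/2) * cos 1 + g * sin 1)\<^sup>2 + ((b - 3/2) * sin 1 - g * cos 1)\<^sup>2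
      = ((b - 3/2)\<^sup>2 + g\<^sup>2) * ((sin 1)\<^sup>2 + (cos 1)\<^sup>2)"
    by algebra
  also have "\<dots> = 5/4"
    using assms by simp
  finally have "((b - 3/2) * sin 1 - g * cos 1)\<^sup>2 = 5/4 - (3/2)\<^sup>2"
    using sq by linarith
  also have "\<dots> < 0"
    by (simp add: power2_eq_square)
  finally show False
    using zero_le_power2[of "(b - 3/2) * sin 1 - g * cos 1"] by linarith
qed

text \<open>The coordinates \<open>h1\<close>, \<open>h2\<close>, \<open>h3\<close> invert
  \<open>circle_map\<close> up to a scale \<open>d\<close>, which is the denominator in its
  definition.\<close>

lemma h_circle_map:
  assumes "(b - 3/2)\<^sup>2 + g\<^sup>2 = 5/4"
  obtains d where "d \<noteq> 0" "d * h1 (circle_map b g) = b - 3/2" "d * h2 (circle_map b g) = g"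
    "d * h3 (circle_map b g) = 1"
proof
  define d where "d = (b - 3/2) * cos 1 + g * sin 1 + 3/2"
  define v where "v = (3/2 - b) * sin 1 + g * cos 1"
  show d: "d \<noteq> 0"
    using circle_map_denom_nonzero[OF assms] by (simp add: d_def)
  have map: "circle_map b g = (1 / d, v / d)"
    by (simp add: circle_map_def d_def v_def Let_def)
  show "d * h3 (circle_map b g) = 1"
    using d by (simp add: map h3_def)
  have "d * h1 (circle_map b g) = (d - 3/2) * cos 1 - v * sin 1"
    using d by (simp add: map h1_def field_simps)
  also have "\<dots> = (b - 3/2) * ((sin 1)\<^sup>2 + (cos 1)\<^sup>2)"
    unfolding d_def v_def by algebra
  finally show "d * h1 (circle_map b g) = b - 3/2"
    by simp
  have "d * h2 (circle_map b g) = (d - 3/2) * sin 1 + v * cos 1"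
    using d by (simp add: map h2_def field_simps)
  also have "\<dots> = g * ((sin 1)\<^sup>2 + (cos 1)\<^sup>2)"
    unfolding d_def v_def by algebra
  finally show "d * h2 (circle_map b g) = g"
    by simp
qed

lemma circle_map_in_k0:
  assumes "(b - 3/2)\<^sup>2 + g\<^sup>2 = 5/4"
  shows "circle_map b g \<in> k0"
proof -
  let ?z = "circle_map b g"
  obtain d where d: "d \<noteq> 0" "d * h1 ?z = b - 3/2" "d * h2 ?z = g" "d * h3 ?z = 1"
    using assms by (rule h_circle_map)
  have "(d * h1 ?z)\<^sup>2 + (d * h2 ?z)\<^sup>2 = 5/4 * (d * h3 ?z)\<^sup>2"
    using assms by (simp add: d)
  then have "d\<^sup>2 * ((h1 ?z)\<^sup>2 + (h2 ?z)\<^sup>2) = d\<^sup>2 * (5/4 * (h3 ?z)\<^sup>2)"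
    by (simp add: power_mult_distrib algebra_simps)
  then have "(h1 ?z)\<^sup>2 + (h2 ?z)\<^sup>2 = 5/4 * (h3 ?z)\<^sup>2"
    using d(1) by simp
  then have "(1 - 3/2 * fst ?z)\<^sup>2 + (snd ?z)\<^sup>2 = 5/4 * (fst ?z)\<^sup>2"
    by (simp only: sum_squares_h h3_def)
  then have "(fst ?z - 3/2)\<^sup>2 + (snd ?z)\<^sup>2 = 5/4"
    by (simp add: power2_eq_square algebra_simps)
  then show ?thesis
    by (simp add: k0_def case_prod_beta)
qed

text \<open>The preimage is read off from the affine coordinates \<open>h1 z / h3 z\<close> and
  \<open>h2 z / h3 z\<close>; rotating them back recovers \<open>z\<close>.\<close>

lemma k0_circle_map:
  assumes "z \<in> k0"
  obtains b g where "(b - 3/2)\<^sup>2 + g\<^sup>2 = 5/4" "z = circle_map b g"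
proof
  define u v where "u = h1 z / h3 z" and "v = h2 z / h3 z"
  note z = k0_h[OF assms]
  show "((u + 3/2) - 3/2)\<^sup>2 + v\<^sup>2 = 5/4"
    using z by (simp add: u_def v_def field_simps)
  have "u * cos 1 + v * sin 1 + 3/2 = (h1 z * cos 1 + h2 z * sin 1 + 3/2 * h3 z) / h3 z"
    using z(2) by (simp add: u_def v_def add_divide_distrib)
  also have "h1 z * cos 1 + h2 z * sin 1 + 3/2 * h3 z = (1 - 3/2 * fst z) * ((sin 1)\<^sup>2 + (cos 1)\<^sup>2) + 3/2 * fst z"
    unfolding h1_def h2_def h3_def by algebra
  finally have d: "u * cos 1 + v * sin 1 + 3/2 = 1 / fst z"
    by (simp add: h3_def)
  have "- u * sin 1 + v * cos 1 = (- h1 z * sin 1 + h2 z * cos 1) / h3 z"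
    using z(2) by (simp add: u_def v_def diff_divide_distrib)
  also have "- h1 z * sin 1 + h2 z * cos 1 = snd z * ((sin 1)\<^sup>2 + (cos 1)\<^sup>2)"
    unfolding h1_def h2_def by algebra
  finally have "- u * sin 1 + v * cos 1 = snd z / fst z"
    by (simp add: h3_def)
  then show "z = circle_map (u + 3/2) v"
    using z(2) by (simp add: circle_map_def d h3_def prod_eq_iff)
qed

lemma alg_point_pt:
  assumes "\<alpha> \<in> \<rat>"
  shows "alg_point (pt \<alpha>)"
proof -
  obtain d where d: "d \<noteq> 0" "d * h1 (pt \<alpha>) = beta \<alpha> - 3/2" "d * h2 (pt \<alpha>) = gamma \<alpha>"
      "d * h3 (pt \<alpha>) = 1"
    using h_circle_map[OF beta_gamma_circle[of \<alpha>]] unfolding pt_eq by metis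
  have "beta \<alpha> - 3/2 \<in> \<rat>" "gamma \<alpha> \<in> \<rat>"
    unfolding beta_def gamma_def using assms by auto
  then show ?thesis
    unfolding alg_point_def using d by (intro exI[of _ d]) (simp add: rat_imp_algebraic)
qed

lemma continuous_on_pt: "continuous_on UNIV pt"
proof -
  have "5 - 2 * \<alpha> + \<alpha>\<^sup>2 \<noteq> (0 :: real)" for \<alpha>
    using beta_gamma_denom_pos[of \<alpha>] by simp
  then have "continuous_on UNIV beta" "continuous_on UNIV gamma"
    unfolding beta_def gamma_def by (auto intro!: continuous_intros)
  then show ?thesis
    unfolding pt_eq circle_map_def Let_def
    using circle_map_denom_nonzero[OF beta_gamma_circle] by (auto intro!: continuous_intros)
qed

text \<open>The pencil of lines through \<open>(2, -1)\<close> yields the parametrization by \<open>beta\<close> and \<open>gamma\<close>,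
  which therefore misses that point.\<close>

lemma beta_gamma_onto:
  assumes circle: "(b - 3/2)\<^sup>2 + g\<^sup>2 = 5/4" and ne: "(b, g) \<noteq> (2, - 1)"
  obtains \<alpha> where "beta \<alpha> = b" "gamma \<alpha> = g"
proof
  \<comment> \<open>Along the line from \<open>(2, -1)\<close> to \<open>(b, g)\<close> the
    parametrization gives \<open>(b - 2) / (g + 1) = (2 * \<alpha> - 4) / (\<alpha> + 3)\<close>;
    solving for \<open>\<alpha>\<close> yields \<open>n / m\<close>.\<close>
  define m n where "m = 2 * g - b + 4" and "n = 3 * b + 4 * g - 2"
  have circle': "b\<^sup>2 - 3 * b + g\<^sup>2 + 1 = 0"
    using circle by (simp add: power2_eq_square algebra_simps)
  \<comment> \<open>The equation \<open>m = 0\<close> is that of the tangent at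
    \<open>(2, -1)\<close>, which meets the circle only in the excluded point.\<close>
  have m: "m \<noteq> 0"
  proof
    assume "m = 0"
    then have b: "b = 2 * g + 4"
      by (simp add: m_def)
    have "5 * (g + 1)\<^sup>2 = 0"
      using circle' unfolding b by (simp add: power2_eq_square algebra_simps)
    then show False
      using ne b by simp
  qed
  have den: "5 * m\<^sup>2 - 2 * n * m + n\<^sup>2 = m\<^sup>2 * (5 - 2 * (n / m) + (n / m)\<^sup>2)"
    using m by (simp add: power_divide field_simps power2_eq_square)
  then have nz: "5 * m\<^sup>2 - 2 * n * m + n\<^sup>2 \<noteq> 0"
    using m beta_gamma_denom_pos[of "n / m"] by simp
  have "beta (n / m) = (m\<^sup>2 * (2 + 2 * (n / m)\<^sup>2)) / (5 * m\<^sup>2 - 2 * n * m + n\<^sup>2)"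
    unfolding den beta_def using m by simp
  also have "m\<^sup>2 * (2 + 2 * (n / m)\<^sup>2) = 2 * m\<^sup>2 + 2 * n\<^sup>2"
    using m by (simp add: power_divide distrib_left)
  also have "\<dots> = b * (5 * m\<^sup>2 - 2 * n * m + n\<^sup>2)"
    unfolding m_def n_def using circle' by algebra
  finally show "beta (n / m) = b"
    using nz by simp
  have "gamma (n / m) = (m\<^sup>2 * (1 + 4 * (n / m) - (n / m)\<^sup>2)) / (5 * m\<^sup>2 - 2 * n * m + n\<^sup>2)"
    unfolding den gamma_def using m by simp
  also have "m\<^sup>2 * (1 + 4 * (n / m) - (n / m)\<^sup>2) = m\<^sup>2 + 4 * n * m - n\<^sup>2"
    using m by (simp add: field_simps power2_eq_square)
  also have "\<dots> = g * (5 * m\<^sup>2 - 2 * n * m + n\<^sup>2)"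
    unfolding m_def n_def using circle' by algebra
  finally show "gamma (n / m) = g"
    using nz by simp
qed

lemma Y0_eq: "Y0 = pt ` \<rat>"
  by (auto simp: Y0_def)

text \<open>Every point of \<open>k0\<close> but one is \<open>pt \<alpha>\<close> for a real
  \<open>\<alpha>\<close>, hence a limit of points with rational parameter. The remaining one is the
  limit for \<open>\<alpha>\<close> tending to infinity.\<close>

lemma k0_subset_closure_Y0: "k0 \<subseteq> closure Y0"
proof
  fix z assume "z \<in> k0"
  then obtain b g where circle: "(b - 3/2)\<^sup>2 + g\<^sup>2 = 5/4" and z: "z = circle_map b g"
    by (rule k0_circle_map)
  show "z \<in> closure Y0"
  proof (cases "(b, g) = (2, - 1)")
    case False
    obtain \<alpha> where "beta \<alpha> = b" "gamma \<alpha> = g"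
      by (rule beta_gamma_onto[OF circle False])
    then have "z = pt \<alpha>"
      by (simp add: z pt_eq)
    moreover have "pt ` closure \<rat> \<subseteq> closure Y0"
      unfolding Y0_eq
      by (rule image_closure_subset)
         (auto intro: continuous_on_subset[OF continuous_on_pt] closure_subset[THEN subsetD])
    ultimately show ?thesis
      by (auto simp: Rats_closure_real)
  next
    case True
    then have bg: "b = 2" "g = - 1"
      by simp_all
    \<comment> \<open>Dividing numerators and denominators by \<open>\<alpha>^2\<close> makes the
      limit at infinity a limit at \<open>t = 0\<close>.\<close>
    define t where "t n = inverse (real n)" for n
    have inv: "beta (real n) = (2 * (t n)\<^sup>2 + 2) / (5 * (t n)\<^sup>2 - 2 * t n + 1)"
        "gamma (real n) = ((t n)\<^sup>2 + 4 * t n - 1) / (5 * (t n)\<^sup>2 - 2 * t n + 1)" if "n \<noteq> 0" for n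
      unfolding beta_def gamma_def t_def using that
      by (simp_all add: divide_simps power2_eq_square)
    have t: "t \<longlonglongrightarrow> 0"
      unfolding t_def by (rule lim_inverse_n)
    have "(\<lambda>n. (2 * (t n)\<^sup>2 + 2) / (5 * (t n)\<^sup>2 - 2 * t n + 1)) \<longlonglongrightarrow> (2 * 0\<^sup>2 + 2) / (5 * 0\<^sup>2 - 2 * 0 + 1)"
      by (intro tendsto_intros t) simp
    then have beta: "(\<lambda>n. beta (real n)) \<longlonglongrightarrow> 2"
      by (rule Lim_transform_eventually[THEN tendsto_eq_rhs])
         (auto intro!: eventually_sequentiallyI[of 1] simp: inv)
    have "(\<lambda>n. ((t n)\<^sup>2 + 4 * t n - 1) / (5 * (t n)\<^sup>2 - 2 * t n + 1)) \<longlonglongrightarrow> (0\<^sup>2 + 4 * 0 - 1) / (5 * 0\<^sup>2 - 2 * 0 + 1)"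
      by (intro tendsto_intros t) simp
    then have gamma: "(\<lambda>n. gamma (real n)) \<longlonglongrightarrow> - 1"
      by (rule Lim_transform_eventually[THEN tendsto_eq_rhs])
         (auto intro!: eventually_sequentiallyI[of 1] simp: inv)
    have "(2 - 3/2) * cos 1 + - 1 * sin 1 + 3/2 \<noteq> (0 :: real)"
      using circle_map_denom_nonzero[OF circle] unfolding bg .
    then have "(\<lambda>n. pt (real n)) \<longlonglongrightarrow> circle_map 2 (- 1)"
      unfolding pt_eq circle_map_def Let_def
      by (intro tendsto_intros beta gamma)
    moreover have "pt (real n) \<in> Y0" for n
      by (simp add: Y0_eq)
    ultimately show ?thesis
      unfolding z bg closure_sequential by (intro exI[of _ "\<lambda>n. pt (real n)"]) simp
  qed
qed

lemma dense_Y0: "dense_in_circle Y0 k0"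
  unfolding dense_in_circle_def
proof (intro conjI allI impI)
  show "Y0 \<subseteq> k0"
    using circle_map_in_k0[OF beta_gamma_circle] by (auto simp: Y0_eq pt_eq)
  fix a :: point and \<rho> :: real
  assume "\<rho> > 0 \<and> ball a \<rho> \<inter> k0 \<noteq> {}"
  then have "ball a \<rho> \<inter> closure Y0 \<noteq> {}"
    using k0_subset_closure_Y0 by blast
  then show "Y0 \<inter> ball a \<rho> \<noteq> {}"
    using open_Int_closure_eq_empty[OF open_ball] by blast
qed

text \<open>A finite set is closed, so by density it would contain all of \<open>k0\<close>, which
  includes an arc parametrized injectively by its abscissa.\<close>

lemma infinite_Y0: "infinite Y0"
proof
  assume "finite Y0"
  then have "finite k0"
    using k0_subset_closure_Y0 by (metis closure_closed finite_imp_closed finite_subset)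
  moreover have "(\<lambda>t. (3/2 + t, sqrt (5/4 - t\<^sup>2))) ` {0..1} \<subseteq> k0"
  proof clarify
    fix t :: real assume "t \<in> {0..1}"
    then have "t\<^sup>2 \<le> 1"
      by (simp add: power_le_one)
    then show "(3/2 + t, sqrt (5/4 - t\<^sup>2)) \<in> k0"
      by (simp add: k0_def)
  qed
  ultimately have "finite ((\<lambda>t :: real. (3/2 + t, sqrt (5/4 - t\<^sup>2))) ` {0..1})"
    by (rule finite_subset[rotated])
  moreover have "inj_on (\<lambda>t :: real. (3/2 + t, sqrt (5/4 - t\<^sup>2))) {0..1}"
    by (rule inj_onI) simp
  ultimately have "finite {0..1 :: real}"
    by (rule finite_imageD)
  then show False
    using infinite_Icc[of 0 "1 :: real"] by simp
qed

section \<open>Straightedge constructions\<close>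

fun alg_letter :: "letter \<Rightarrow> bool" where
  "alg_letter (Point z) \<longleftrightarrow> alg_point z"
| "alg_letter (Curve C) \<longleftrightarrow> C = k0 \<or> alg_line C"

text \<open>The circle rule with \<open>q = t\<close> merely repeats the point \<open>p\<close>, so
  \<open>k0\<close> remains the only circle. Of two distinct curves at least one is then a line, and
  the two intersection lemmas cover all cases.\<close>

lemma alg_letter_step:
  assumes u: "\<forall>x\<in>letters u. alg_letter x" and step: "construction_step u a"
    and straight: "\<And>p q t. circle_rule_at u a p q t \<Longrightarrow> q = t"
  shows "alg_letter a"
proof -
  consider "line_rule u a" | p q t where "circle_rule_at u a p q t" | "intersection_rule u a"
    using step by (auto simp: construction_step_def)
  then show ?thesis
  proof cases
    case 1
    then obtain p q where pq: "p \<noteq> q" "Point p \<in> letters u" "Point q \<in> letters u"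
        and a: "a = Curve (line_through p q)"
      unfolding line_rule_def by blast
    have "alg_point p" "alg_point q"
      using u pq(2,3) by force+
    then show ?thesis
      using pq(1) by (simp add: a alg_line_line_through)
  next
    case 2
    then have "q = t"
      by (rule straight)
    with 2 have "a = Point p" "Point p \<in> letters u"
      by (simp_all add: circle_rule_at_def kcirc_def)
    then show ?thesis
      using u by blast
  next
    case 3
    then obtain C D x where CD: "C \<noteq> D" "Curve C \<in> letters u" "Curve D \<in> letters u"
        "x \<in> C" "x \<in> D" and a: "a = Point x"
      unfolding intersection_rule_def by blast
    have "C = k0 \<or> alg_line C" "D = k0 \<or> alg_line D"
      using u CD by fastforce+
    then have "alg_point x"
      using CD alg_point_line_line alg_point_line_circle by metis
    then show ?thesis
      by (simp add: a)
  qed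
qed

lemma EC_inf_edge:
  assumes T: "EC_inf T" and uv: "(u, v) \<in> edges T"
  obtains a where "u \<in> verts T" "construction_step u a" "v = append_letter u a"
proof -
  have u: "u \<in> verts T"
    using assms by (auto simp: EC_inf_def rooted_tree_def)
  moreover have v: "v \<in> children T u"
    using uv by (simp add: children_def)
  then have "\<not> leaf T u"
    by (auto simp: leaf_def)
  then obtain a where "construction_step u a" "children T u = {append_letter u a}"
    using T u by (auto simp: EC_inf_def)
  ultimately show ?thesis
    using that v by blast
qed

lemma successively_last:
  assumes "successively R us" "us \<noteq> []" "P (hd us)" "\<And>u v. R u v \<Longrightarrow> P u \<Longrightarrow> P v"
  shows "P (last us)"
  using assms(1-3)
proof (induction us rule: induct_list012)
  case (3 x y zs)
  then show ?case
    using assms(4)[of x y] by auto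
qed auto

text \<open>The invariant is carried along the walk from the root to \<open>u\<close>, one appended
  letter per edge.\<close>

lemma letters_alg:
  assumes T: "EC_inf T" and straight: "straightedge T"
    and root: "\<forall>x\<in>letters (troot T). alg_letter x" and u: "u \<in> verts T"
  shows "\<forall>x\<in>letters u. alg_letter x"
proof -
  have "\<exists>!us. is_walk T (Fin_walk us) \<and> hd us = troot T \<and> last us = u"
    using T u by (auto simp: EC_inf_def rooted_tree_def)
  then obtain us where us: "us \<noteq> []" "successively (\<lambda>u v. (u, v) \<in> edges T) us"
      "hd us = troot T" "last us = u"
    by auto
  have "\<forall>x\<in>letters (last us). alg_letter x"
  proof (rule successively_last[OF us(2,1)])
    fix u v assume uv: "(u, v) \<in> edges T" and IH: "\<forall>x\<in>letters u. alg_letter x"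
    obtain a where a: "construction_step u a" "v = append_letter u a"
      using T uv by (rule EC_inf_edge)
    have "alg_letter a"
      using IH a(1)
    proof (rule alg_letter_step)
      show "q = t" if "circle_rule_at u a p q t" for p q t
        using straight uv that unfolding a(2) straightedge_def by blast
    qed
    then show "\<forall>x\<in>letters v. alg_letter x"
      using IH by (auto simp: a(2) letters_def append_letter_def)
  qed (use root us in simp)
  then show ?thesis
    by (simp add: us(4))
qed

lemma center_not_letter:
  assumes "EC_inf T" "straightedge T" "troot T = root_word p" "p ` {1..} = Y0" "u \<in> verts T"
  shows "Point c0 \<notin> letters u"
proof
  assume c0: "Point c0 \<in> letters u"
  \<comment> \<open>Letter 0 of the root is the circle; the given points start at index 1.\<close>
  have "alg_point (p n)" if "n \<noteq> 0" for n
  proof -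
    have "p n \<in> Y0"
      using that by (auto simp flip: assms(4))
    then show ?thesis
      by (auto simp: Y0_eq alg_point_pt)
  qed
  then have "\<forall>x\<in>letters (troot T). alg_letter x"
    by (auto simp: assms(3) letters_def root_word_def)
  then have "alg_letter (Point c0)"
    using letters_alg assms c0 by blast
  then show False
    by (simp add: not_alg_point_center)
qed

lemma EC_inf_no_edge_to_root:
  assumes "EC_inf T"
  shows "(v, troot T) \<notin> edges T"
proof
  assume "(v, troot T) \<in> edges T"
  with assms obtain a where "troot T = append_letter v a"
    by (rule EC_inf_edge)
  then have "snd (troot T) \<noteq> []"
    by (metis append_letter_def append_is_Nil_conv not_Cons_self2 snd_conv)
  then show False
    using assms by (simp add: EC_inf_def)
qed

text \<open>Without a leaf the condition on leaves in \<open>constructs\<close> would hold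
  vacuously. Following children forever from the root gives an infinite walk, and it is a branch
  because no edge enters the root.\<close>

lemma terminating_has_leaf:
  assumes T: "EC_inf T" and fin: "terminating T"
  obtains u where "leaf T u"
proof (rule ccontr)
  assume "\<not> thesis"
  then have no_leaf: "\<not> leaf T u" for u
    using that by blast
  have "\<exists>v. (u, v) \<in> edges T" if "u \<in> verts T" for u
    using no_leaf[of u] that by (auto simp: leaf_def children_def)
  then obtain s where s: "\<And>u. u \<in> verts T \<Longrightarrow> (u, s u) \<in> edges T"
    by metis
  have edges: "edges T \<subseteq> verts T \<times> verts T" and root: "troot T \<in> verts T"
    using T by (auto simp: EC_inf_def rooted_tree_def)
  define f where "f n = (s ^^ n) (troot T)" for n
  have f_Suc: "f (Suc n) = s (f n)" for n
    by (simp add: f_def)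
  have verts: "f n \<in> verts T" for n
  proof (induction n)
    case (Suc n)
    have "(f n, f (Suc n)) \<in> verts T \<times> verts T"
      using s[OF Suc] edges by (auto simp only: f_Suc)
    then show ?case
      by simp
  qed (simp add: f_def root)
  have walk: "is_walk T (Inf_walk f)"
    using verts s[OF verts] by (simp add: f_Suc image_subset_iff)
  have "branch T (Inf_walk f)"
    unfolding branch_def
  proof (intro conjI allI impI walk)
    fix W assume W: "is_walk T W \<and> subwalk (Inf_walk f) W"
    show "W = Inf_walk f"
    proof (cases W)
      case (Inf_walk g)
      then obtain i where i: "\<And>n. f n = g (i + n)"
        using W by auto
      have g: "(g n, g (Suc n)) \<in> edges T" for n
        using W Inf_walk by simp
      \<comment> \<open>A walk that extends \<open>f\<close> to the left would contain an edge into
        the root.\<close>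
      have "i = 0"
      proof (rule ccontr)
        assume "i \<noteq> 0"
        then have "(g (i - 1), g i) \<in> edges T"
          using g[of "i - 1"] by simp
        moreover have "g i = troot T"
          using i[of 0] by (simp add: f_def)
        ultimately show False
          using EC_inf_no_edge_to_root[OF T] by simp
      qed
      then have "g = f"
        using i by auto
      then show ?thesis
        using Inf_walk by simp
    qed (use W in auto)
  qed
  then show False
    using fin by (auto simp: terminating_def)
qed

theorem theorem3p4:
  "countable Y0 \<and> infinite Y0 \<and> dense_in_circle Y0 k0 \<and>
   (\<forall>p :: nat \<Rightarrow> point. p ` {1..} = Y0 \<longrightarrow>
      (\<forall>T. EC_inf T \<and> straightedge T \<and> troot T = root_word p \<longrightarrow>
           (\<forall>u\<in>verts T. Point c0 \<notin> letters u)) \<and>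
      \<not> constructs straightedge {[Point c0]} (root_word p))"
proof (intro conjI allI impI)
  show "countable Y0"
    unfolding Y0_eq by (intro countable_image countable_rat)
  show "infinite Y0" "dense_in_circle Y0 k0"
    by (rule infinite_Y0 dense_Y0)+
  fix p :: "nat \<Rightarrow> point" assume p: "p ` {1..} = Y0"
  show "\<forall>u\<in>verts T. Point c0 \<notin> letters u"
    if "EC_inf T \<and> straightedge T \<and> troot T = root_word p" for T
    using that p center_not_letter by blast
  show "\<not> constructs straightedge {[Point c0]} (root_word p)"
  proof
    assume "constructs straightedge {[Point c0]} (root_word p)"
    then obtain T where T: "EC_inf T" "straightedge T" "terminating T" "troot T = root_word p"
      and final: "\<And>u. leaf T u \<Longrightarrow> final_segment [Point c0] u"
      by (auto simp: constructs_def)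
    obtain u where u: "leaf T u"
      using T(1,3) by (rule terminating_has_leaf)
    have "Point c0 \<in> letters u"
      using final[OF u] set_mono_suffix by (fastforce simp: final_segment_def letters_def)
    moreover have "u \<in> verts T"
      using u by (simp add: leaf_def)
    ultimately show False
      using T p center_not_letter by blast
  qed
qed

end
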